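(* Let $\mathcal{S}$ be a finite state space, $P$ a (time-homogeneous) transition matrix on $\mathcal{S}$, and $g:\mathcal{S}\times\mathcal{S}\to\mathbb{R}$ a reward function. Suppose that the Markov chain with transition matrix $P$ is unichain (it has exactly one recurrent class, possibly together with transient states) and aperiodic. Let $\mu_0$ be an arbitrary probability distribution on $\mathcal{S}$, let $(X^{(j)}_t)_{t\ge 0}$, $j=0,1,2,\dots$, be independent realizations of the Markov chain with transition matrix $P$ and initial distribution $\mu_0$, and let $r^{(j)}_t = g(X^{(j)}_t,X^{(j)}_{t+1})$ be the resulting rewards. Then the reward process is asymptotically ergodic, that is, for all realizations $i$, $$\lim_{N,\,t\to\infty}\frac{1}{N}\sum_{j=0}^{N} r^{(j)}_{t} \;=\; \lim_{T\to\infty}\frac{1}{T}\sum_{\kappa=0}^{T} r^{(i)}_{\kappa}$$ almost surely, where the limit on the left is the joint limit as both $N\to\infty$ and $t\to\infty$.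
   Context: A Markov reward process is a Markov chain on a state space $\mathcal{S}$ together with a reward function, here on transitions: when the chain moves from $X_t$ to $X_{t+1}$, the reward $r_t=g(X_t,X_{t+1})$ is received. A finite Markov chain is called unichain if it has a single recurrent class (plus possibly transient states); such a chain is aperiodic if its recurrent class has period $1$. The notation $r^{(j)}_t$ denotes the reward received at time step $t\in\mathbb{N}=\{0,1,2,\dots\}$ of the $j$-th trajectory, the trajectories being realizations of the same stochastic process. A reward process $r^{(i)}_t$ is called asymptotically ergodic if, for all realizations $i$, $\lim_{N,\,t\to\infty}\frac{1}{N}\sum_{j=0}^{N} r^{(j)}_{t} = \lim_{T\to\infty}\frac{1}{T}\sum_{\kappa=0}^{T} r^{(i)}_{\kappa}$ almost surely, where $\lim_{N,\,t\to\infty}$ is the joint limit in the number of trajectories $N$ and the time step $t$.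
   Formalization: The almost sure joint limit in N and t, false as stated (e.g. for fair coin rewards), is replaced by almost sure convergence along each fixed path (N_k, t_k) with N_k strictly increasing and t_k tending to infinity, the exceptional null set depending on the path. *)

theory Defs
  imports "HOL-Probability.Probability"
begin

section \<open>Transition matrices on a finite state space\<close>

definition transition_matrix :: "('s::finite \<Rightarrow> 's \<Rightarrow> real) \<Rightarrow> bool" where
  "transition_matrix P \<longleftrightarrow> (\<forall>x y. 0 \<le> P x y) \<and> (\<forall>x. (\<Sum>y\<in>UNIV. P x y) = 1)"

primrec n_step :: "('s::finite \<Rightarrow> 's \<Rightarrow> real) \<Rightarrow> nat \<Rightarrow> 's \<Rightarrow> 's \<Rightarrow> real" where
  "n_step P 0 x y = (if x = y then 1 else 0)"
| "n_step P (Suc n) x y = (\<Sum>z\<in>UNIV. P x z * n_step P n z y)"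

text \<open>\<^term>\<open>first_passage P n x y\<close> is the probability that the chain started in \<^term>\<open>x\<close>
  visits \<^term>\<open>y\<close> for the first time after time \<open>0\<close> exactly at time \<open>n + 1\<close>.\<close>

primrec first_passage :: "('s::finite \<Rightarrow> 's \<Rightarrow> real) \<Rightarrow> nat \<Rightarrow> 's \<Rightarrow> 's \<Rightarrow> real" where
  "first_passage P 0 x y = P x y"
| "first_passage P (Suc n) x y = (\<Sum>z\<in>UNIV - {y}. P x z * first_passage P n z y)"

definition recurrent :: "('s::finite \<Rightarrow> 's \<Rightarrow> real) \<Rightarrow> 's \<Rightarrow> bool" where
  "recurrent P x \<longleftrightarrow> (\<lambda>n. first_passage P n x x) sums 1"

definition accessible :: "('s::finite \<Rightarrow> 's \<Rightarrow> real) \<Rightarrow> 's \<Rightarrow> 's \<Rightarrow> bool" where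
  "accessible P x y \<longleftrightarrow> (\<exists>n. n_step P n x y > 0)"

definition communicating_class :: "('s::finite \<Rightarrow> 's \<Rightarrow> real) \<Rightarrow> 's \<Rightarrow> 's set" where
  "communicating_class P x = {y. accessible P x y \<and> accessible P y x}"

definition recurrent_classes :: "('s::finite \<Rightarrow> 's \<Rightarrow> real) \<Rightarrow> 's set set" where
  "recurrent_classes P = {communicating_class P x | x. recurrent P x}"

definition unichain :: "('s::finite \<Rightarrow> 's \<Rightarrow> real) \<Rightarrow> bool" where
  "unichain P \<longleftrightarrow> (\<exists>!C. C \<in> recurrent_classes P)"

definition period :: "('s::finite \<Rightarrow> 's \<Rightarrow> real) \<Rightarrow> 's \<Rightarrow> nat" where
  "period P x = Gcd {n. n > 0 \<and> n_step P n x x > 0}"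

definition aperiodic :: "('s::finite \<Rightarrow> 's \<Rightarrow> real) \<Rightarrow> bool" where
  "aperiodic P \<longleftrightarrow> (\<forall>C\<in>recurrent_classes P. \<forall>x\<in>C. period P x = 1)"


section \<open>Markov chains and independent realizations\<close>

definition markov_chain ::
  "'w measure \<Rightarrow> (nat \<Rightarrow> 'w \<Rightarrow> 's::finite) \<Rightarrow> ('s \<Rightarrow> 's \<Rightarrow> real) \<Rightarrow> 's pmf \<Rightarrow> bool" where
  "markov_chain M X P \<mu>\<^sub>0 \<longleftrightarrow>
     prob_space M \<and>
     (\<forall>t. X t \<in> measurable M (count_space UNIV)) \<and>
     distr M (count_space UNIV) (X 0) = measure_pmf \<mu>\<^sub>0 \<and>
     (\<forall>t x y. \<P>(\<omega> in M. \<forall>s\<le>t. X s \<omega> = x s) > 0 \<longrightarrow>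
        \<P>(\<omega> in M. X (Suc t) \<omega> = y \<bar> \<forall>s\<le>t. X s \<omega> = x s) = P (x t) y)"

text \<open>The trajectories are independent as random elements of the path space.\<close>

definition independent_realizations ::
  "'w measure \<Rightarrow> (nat \<Rightarrow> nat \<Rightarrow> 'w \<Rightarrow> 's::finite) \<Rightarrow> ('s \<Rightarrow> 's \<Rightarrow> real) \<Rightarrow> 's pmf \<Rightarrow> bool" where
  "independent_realizations M X P \<mu>\<^sub>0 \<longleftrightarrow>
     (\<forall>j. markov_chain M (X j) P \<mu>\<^sub>0) \<and>
     prob_space.indep_vars M (\<lambda>_. Pi\<^sub>M UNIV (\<lambda>_. count_space UNIV)) (\<lambda>j \<omega> t. X j t \<omega>) UNIV"

definition reward :: "('s \<times> 's \<Rightarrow> real) \<Rightarrow> (nat \<Rightarrow> nat \<Rightarrow> 'w \<Rightarrow> 's) \<Rightarrow> nat \<Rightarrow> nat \<Rightarrow> 'w \<Rightarrow> real" where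
  "reward g X j t \<omega> = g (X j t \<omega>, X j (Suc t) \<omega>)"


section \<open>Almost sure joint limits\<close>

text \<open>For a double sequence of numbers, the joint limit along
  \<open>sequentially \<times>\<^sub>F sequentially\<close> is the common limit along all sequences
  of index pairs with both components tending to infinity, and it suffices to let the first
  component be strictly increasing.\<close>

lemma joint_limit_iff_paths:
  fixes f :: "nat \<Rightarrow> nat \<Rightarrow> 'a::topological_space"
  shows "((\<lambda>(N, t). f N t) \<longlongrightarrow> l) (sequentially \<times>\<^sub>F sequentially) \<longleftrightarrow>
    (\<forall>n \<tau>. strict_mono n \<longrightarrow> filterlim \<tau> at_top sequentially \<longrightarrow> (\<lambda>k. f (n k) (\<tau> k)) \<longlonglongrightarrow> l)"
  (is "?L \<longleftrightarrow> ?R")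
proof
  assume L: ?L
  show ?R
  proof (intro allI impI)
    fix n \<tau> :: "nat \<Rightarrow> nat"
    assume n: "strict_mono n" and \<tau>: "filterlim \<tau> at_top sequentially"
    have "filterlim (\<lambda>k. (n k, \<tau> k)) (sequentially \<times>\<^sub>F sequentially) sequentially"
      using filterlim_subseq[OF n] \<tau> by (rule filterlim_Pair)
    from filterlim_compose[OF L this] show "(\<lambda>k. f (n k) (\<tau> k)) \<longlonglongrightarrow> l"
      by simp
  qed
next
  assume R: ?R
  show ?L
  proof (rule ccontr)
    assume "\<not> ?L"
    then obtain S where S: "open S" "l \<in> S"
      and nS: "\<not> eventually (\<lambda>(N, t). f N t \<in> S) (sequentially \<times>\<^sub>F sequentially)"
      unfolding tendsto_def by (auto simp: case_prod_unfold)
    have ex: "\<exists>N\<ge>m. \<exists>t\<ge>m. f N t \<notin> S" for m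
      using nS unfolding eventually_prod_sequentially by simp blast
    have "\<exists>p. \<forall>k. (f (fst (p k)) (snd (p k)) \<notin> S \<and> snd (p k) \<ge> k) \<and> fst (p k) < fst (p (Suc k))"
    proof (rule dependent_nat_choice)
      show "\<exists>x. f (fst x) (snd x) \<notin> S \<and> 0 \<le> snd x"
        using ex[of 0] by auto
      fix x :: "nat \<times> nat" and k
      show "\<exists>y. (f (fst y) (snd y) \<notin> S \<and> Suc k \<le> snd y) \<and> fst x < fst y"
        using ex[of "Suc (fst x) + Suc k"] by fastforce
    qed
    then obtain p where p: "\<And>k. f (fst (p k)) (snd (p k)) \<notin> S" "\<And>k. snd (p k) \<ge> k"
      "\<And>k. fst (p k) < fst (p (Suc k))"
      by blast
    have "strict_mono (\<lambda>k. fst (p k))"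
      using p(3) by (simp add: strict_mono_Suc_iff)
    moreover have "filterlim (\<lambda>k. snd (p k)) at_top sequentially"
      by (rule filterlim_at_top_mono[OF filterlim_ident]) (simp add: p(2))
    ultimately have "(\<lambda>k. f (fst (p k)) (snd (p k))) \<longlonglongrightarrow> l"
      using R by blast
    from topological_tendstoD[OF this S] p(1) show False
      by simp
  qed
qed

text \<open>For random double sequences this sequential form is required almost surely along each
  path \<open>(n, \<tau>)\<close>, the exceptional null set being allowed to depend on the path. A null set
  uniform in all (uncountably many) paths is not what is meant: for empirical means of
  independent fair coin tosses, for every fixed \<open>N\<close> almost surely infinitely many
  times \<open>t\<close> show \<open>N + 1\<close> heads and infinitely many show \<open>N + 1\<close> tails, so that
  the pathwise limit along \<open>sequentially \<times>\<^sub>F sequentially\<close> almost surely does not exist.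
  For the same reason \<open>n\<close> is required to be strictly increasing: along \<open>\<tau> = id\<close> and a
  nondecreasing \<open>n\<close> tending to infinity slower than any logarithm, the empirical means almost
  surely diverge.\<close>

definition as_joint_limit ::
  "'w measure \<Rightarrow> (nat \<Rightarrow> nat \<Rightarrow> 'w \<Rightarrow> real) \<Rightarrow> ('w \<Rightarrow> real) \<Rightarrow> bool" where
  "as_joint_limit M A L \<longleftrightarrow>
     (\<forall>n \<tau>. strict_mono n \<longrightarrow> filterlim \<tau> at_top sequentially \<longrightarrow>
        (AE \<omega> in M. (\<lambda>k. A (n k) (\<tau> k) \<omega>) \<longlonglongrightarrow> L \<omega>))"

text \<open>In particular, the joint limit holds in probability in the full sense of
  \<open>sequentially \<times>\<^sub>F sequentially\<close>.\<close>

lemma as_joint_limit_imp_in_probability: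
  assumes "prob_space M" and A: "\<And>N t. A N t \<in> borel_measurable M"
    and L: "L \<in> borel_measurable M" and "as_joint_limit M A L" and "\<epsilon> > 0"
  shows "((\<lambda>(N, t). \<P>(\<omega> in M. \<bar>A N t \<omega> - L \<omega>\<bar> \<ge> \<epsilon>)) \<longlongrightarrow> 0) (sequentially \<times>\<^sub>F sequentially)"
  unfolding joint_limit_iff_paths
proof (intro allI impI)
  interpret prob_space M by fact
  fix n \<tau> :: "nat \<Rightarrow> nat"
  assume "strict_mono n" "filterlim \<tau> at_top sequentially"
  with assms have ae: "AE \<omega> in M. (\<lambda>k. A (n k) (\<tau> k) \<omega>) \<longlonglongrightarrow> L \<omega>"
    unfolding as_joint_limit_def by blast
  let ?B = "\<lambda>k. {\<omega> \<in> space M. \<bar>A (n k) (\<tau> k) \<omega> - L \<omega>\<bar> \<ge> \<epsilon>}"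
  have B [measurable]: "?B k \<in> sets M" for k
    using A L by measurable
  have "(\<lambda>k. integral\<^sup>L M (indicator (?B k) :: _ \<Rightarrow> real)) \<longlonglongrightarrow> integral\<^sup>L M (\<lambda>_. 0)"
  proof (rule integral_dominated_convergence[where w = "\<lambda>_. 1"])
    show "AE \<omega> in M. (\<lambda>k. indicator (?B k) \<omega> :: real) \<longlonglongrightarrow> 0"
      using ae
    proof eventually_elim
      case (elim \<omega>)
      have "eventually (\<lambda>k. \<bar>A (n k) (\<tau> k) \<omega> - L \<omega>\<bar> < \<epsilon>) sequentially"
        using tendstoD[OF elim \<open>\<epsilon> > 0\<close>] by (simp add: dist_real_def)
      then have "eventually (\<lambda>k. (indicator (?B k) \<omega> :: real) = 0) sequentially"
        by eventually_elim (simp add: indicator_def)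
      then show ?case
        by (rule tendsto_eventually)
    qed
  qed (auto simp: indicator_def)
  then show "(\<lambda>k. \<P>(\<omega> in M. \<bar>A (n k) (\<tau> k) \<omega> - L \<omega>\<bar> \<ge> \<epsilon>)) \<longlonglongrightarrow> 0"
    using B by simp
qed


section \<open>Asymptotic ergodicity\<close>

text \<open>Existence of both limits is part of the definition; \<^term>\<open>L\<close> is their common value.
  The value at \<open>N = 0\<close> (division by zero) is irrelevant for the limits.\<close>

definition asymptotically_ergodic ::
  "'w measure \<Rightarrow> (nat \<Rightarrow> nat \<Rightarrow> 'w \<Rightarrow> real) \<Rightarrow> bool" where
  "asymptotically_ergodic M r \<longleftrightarrow>
     (\<forall>i. \<exists>L\<in>borel_measurable M.
        as_joint_limit M (\<lambda>N t \<omega>. (1 / real N) * (\<Sum>j=0..N. r j t \<omega>)) L \<and>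
        (AE \<omega> in M. (\<lambda>T. (1 / real T) * (\<Sum>\<kappa>=0..T. r i \<kappa> \<omega>)) \<longlonglongrightarrow> L \<omega>))"

end

theory Submission
  imports Defs
begin

text \<open>Every state leads to an essential state, and essential states are recurrent; so for a unichain
  some state \<open>z\<close> is accessible from everywhere, and aperiodicity yields an \<open>N\<close> with
  \<open>P\<^sup>N(x, z) > 0\<close> for all \<open>x\<close>. Hence \<open>P\<^sup>N\<close> contracts oscillations and
  \<open>P\<^sup>t f\<close> converges to a constant \<open>L\<close>, where \<open>f\<close> is the expected one-step reward. The mean
  reward at time \<open>t\<close> is \<open>\<mu>\<^sub>0 P\<^sup>t f\<close> and tends to \<open>L\<close>; the empirical mean over \<open>N\<close>
  trajectories deviates from it by \<open>\<epsilon>\<close> with probability at most \<open>2 q\<^sup>N\<close> uniformly in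
  \<open>t\<close> (Hoeffding), which is summable along any strictly increasing sequence of \<open>N\<close>. The time
  average is reduced to bounded martingale differences by a truncated Poisson equation, and their
  averages vanish almost surely by a fourth moment bound and Borel--Cantelli.\<close>

section \<open>Finite stochastic matrices\<close>

text \<open>The least positive difference of two elements divides every element, since a remainder
  would be a smaller difference. So it is 1, and two consecutive elements \<open>b\<close>,
  \<open>b + 1\<close> generate every number from \<open>b * b\<close> on.\<close>

lemma eventually_mem_if_Gcd_1:
  fixes S :: "nat set"
  assumes add: "\<And>a b. a \<in> S \<Longrightarrow> b \<in> S \<Longrightarrow> a + b \<in> S" and zero: "0 \<in> S" and Gcd: "Gcd S = 1"
  shows "\<exists>m. \<forall>n\<ge>m. n \<in> S"
proof -
  have mult: "k * a \<in> S" if "a \<in> S" for k a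
    by (induction k) (use zero add that in auto)
  define D where "D = (\<lambda>d. d > 0 \<and> (\<exists>b. b \<in> S \<and> b + d \<in> S))"
  have "\<exists>a\<in>S. a \<noteq> 0"
    using Gcd by (metis Gcd_0_iff subsetI singletonI zero_neq_one)
  then have "\<exists>d. D d"
    using zero unfolding D_def by (metis add_0 gr0I)
  define d where "d = (LEAST d. D d)"
  have "D d"
    unfolding d_def using \<open>\<exists>d. D d\<close> by (rule LeastI_ex)
  then obtain b where d: "d > 0" "b \<in> S" "b + d \<in> S"
    unfolding D_def by blast
  have "d dvd s" if "s \<in> S" for s
  proof (rule ccontr)
    assume "\<not> d dvd s"
    then have "s mod d > 0" by (simp add: dvd_eq_mod_eq_0)
    \<comment> \<open>This exhibits the remainder \<open>s mod d\<close> as a difference of two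
      elements of \<open>S\<close>.\<close>
    moreover have "s div d * (b + d) + s mod d = s + s div d * b"
      by (simp add: algebra_simps)
    then have "s div d * (b + d) + s mod d \<in> S"
      using add mult that d by simp
    ultimately have "D (s mod d)"
      using mult d unfolding D_def by blast
    then have "d \<le> s mod d"
      unfolding d_def by (rule Least_le)
    then show False
      using mod_less_divisor[OF d(1), of s] by linarith
  qed
  then have "d dvd Gcd S"
    by (rule Gcd_greatest)
  then have "b + 1 \<in> S"
    using Gcd d by simp
  have "n \<in> S" if "n \<ge> b * b" for n
  proof (cases "b = 0")
    case True
    then show ?thesis
      using mult[OF \<open>b + 1 \<in> S\<close>, of n] by simp
  next
    case False
    \<comment> \<open>The quotient must be at least the remainder: then \<open>n mod b\<close> of
      the \<open>n div b\<close> copies of \<open>b\<close> can be raised to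
      \<open>b + 1\<close>.\<close>
    have "b \<le> n div b"
      using that False by (simp add: less_eq_div_iff_mult_less_eq)
    then have "n mod b \<le> n div b"
      using False mod_less_divisor[of b n] by linarith
    then obtain c where c: "n div b = n mod b + c"
      using le_Suc_ex by blast
    have "n = n div b * b + n mod b"
      by simp
    also have "\<dots> = n mod b * (b + 1) + c * b"
      unfolding c by (simp add: algebra_simps)
    also have "\<dots> \<in> S"
      by (intro add mult[OF \<open>b + 1 \<in> S\<close>] mult[OF d(2)])
    finally show ?thesis .
  qed
  then show ?thesis by blast
qed

section \<open>Powers of a stochastic matrix and accessibility\<close>

locale stochastic_matrix =
  fixes P :: "'s::finite \<Rightarrow> 's \<Rightarrow> real"
  assumes transition_matrix: "transition_matrix P"
begin

lemma P_nonneg [simp]: "0 \<le> P x y" and P_sum [simp]: "(\<Sum>y\<in>UNIV. P x y) = 1"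
  using transition_matrix unfolding transition_matrix_def by auto

lemma P_eq_0: "\<not> P x y > 0 \<Longrightarrow> P x y = 0"
  using P_nonneg[of x y] by linarith

lemma n_step_nonneg [simp]: "0 \<le> n_step P n x y"
  by (induction n arbitrary: x) (auto intro!: sum_nonneg)

text \<open>The Chapman-Kolmogorov equation.\<close>

lemma n_step_add: "n_step P (m + n) x y = (\<Sum>z\<in>UNIV. n_step P m x z * n_step P n z y)"
proof (induction m arbitrary: x)
  case 0
  then show ?case
    by (simp add: if_distrib[of "\<lambda>c. c * _"] cong: if_cong)
next
  case (Suc m)
  then have "n_step P (Suc m + n) x y
      = (\<Sum>w\<in>UNIV. \<Sum>z\<in>UNIV. P x w * (n_step P m w z * n_step P n z y))"
    by (simp add: sum_distrib_left)
  also have "\<dots> = (\<Sum>z\<in>UNIV. \<Sum>w\<in>UNIV. P x w * (n_step P m w z * n_step P n z y))"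
    by (rule sum.swap)
  finally show ?case
    by (simp add: sum_distrib_right mult.assoc)
qed

lemma n_step_pos_trans:
  assumes "n_step P m x y > 0" "n_step P n y z > 0"
  shows "n_step P (m + n) x z > 0"
  unfolding n_step_add by (rule sum_pos2[of _ y]) (use assms in auto)

lemma accessible_refl: "accessible P x x"
  unfolding accessible_def by (rule exI[of _ 0]) simp

lemma accessible_trans: "accessible P x y \<Longrightarrow> accessible P y z \<Longrightarrow> accessible P x z"
  unfolding accessible_def using n_step_pos_trans by blast

lemma accessible_step: "P x y > 0 \<Longrightarrow> accessible P x y"
  unfolding accessible_def
  by (rule exI[of _ 1]) (simp add: if_distrib[of "\<lambda>c. _ * c"] cong: if_cong)

lemma exists_successor: "\<exists>y. P x y > 0"
proof (rule ccontr)
  assume "\<not> (\<exists>y. P x y > 0)"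
  then have "P x y = 0" for y
    using P_eq_0 by blast
  then show False
    using P_sum[of x] by simp
qed

section \<open>Essential states and recurrence\<close>

definition essential :: "'s \<Rightarrow> bool" where
  "essential z \<longleftrightarrow> (\<forall>y. accessible P z y \<longrightarrow> accessible P y z)"

text \<open>Moving from an inessential state to one that does not lead back strictly shrinks the set
  of reachable states, so by finiteness the search ends.\<close>

lemma exists_essential: "\<exists>z. accessible P x z \<and> essential z"
proof (induction "card {y. accessible P x y}" arbitrary: x rule: less_induct)
  case less
  show ?case
  proof (cases "essential x")
    case True
    then show ?thesis
      using accessible_refl by blast
  next
    case False
    then obtain y where y: "accessible P x y" "\<not> accessible P y x"
      unfolding essential_def by blast
    then have "{w. accessible P y w} \<subset> {w. accessible P x w}"
      using accessible_trans accessible_refl by blast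
    then have "card {w. accessible P y w} < card {w. accessible P x w}"
      by (intro psubset_card_mono) auto
    from less[OF this] show ?thesis
      using y accessible_trans by blast
  qed
qed

lemma first_passage_nonneg: "0 \<le> first_passage P n x z"
  by (induction n arbitrary: x) (auto intro!: sum_nonneg)

text \<open>The probability that the chain from \<open>x\<close> does not visit \<open>z\<close> at
  any of the times 1 to \<open>n\<close>; the index \<open>k\<close> of \<open>first_passage\<close>
  stands for time \<open>k + 1\<close>.\<close>

definition avoid :: "'s \<Rightarrow> nat \<Rightarrow> 's \<Rightarrow> real" where
  "avoid z n x = 1 - (\<Sum>k<n. first_passage P k x z)"

text \<open>First-step analysis. In this form nonnegativity follows by induction, and the limit in
  \<open>n\<close> can be taken on both sides.\<close>

lemma avoid_Suc: "avoid z (Suc n) x = (\<Sum>y\<in>UNIV - {z}. P x y * avoid z n y)"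
proof -
  have "(\<Sum>k<Suc n. first_passage P k x z)
      = P x z + (\<Sum>k<n. \<Sum>y\<in>UNIV - {z}. P x y * first_passage P k y z)"
    by (simp add: sum.lessThan_Suc_shift del: sum.lessThan_Suc)
  also have "(\<Sum>k<n. \<Sum>y\<in>UNIV - {z}. P x y * first_passage P k y z)
      = (\<Sum>y\<in>UNIV - {z}. P x y * (\<Sum>k<n. first_passage P k y z))"
    by (subst sum.swap) (simp add: sum_distrib_left)
  moreover have "1 = P x z + (\<Sum>y\<in>UNIV - {z}. P x y)"
    using P_sum[of x] by (subst sum.remove[symmetric]) auto
  ultimately show ?thesis
    unfolding avoid_def by (simp add: right_diff_distrib sum_subtractf)
qed

lemma avoid_nonneg: "0 \<le> avoid z n x"
proof (induction n arbitrary: x)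
  case 0
  then show ?case by (simp add: avoid_def)
next
  case (Suc n)
  then show ?case
    by (auto simp: avoid_Suc intro!: sum_nonneg)
qed

text \<open>The limiting avoidance probabilities are harmonic off \<open>z\<close>, so the set where they attain
  a positive maximum is closed under transitions and misses \<open>z\<close>.\<close>

lemma essential_imp_recurrent:
  assumes "essential z"
  shows "recurrent P z"
proof -
  have dec: "decseq (\<lambda>n. avoid z n x)" for x
    by (rule decseq_SucI) (simp add: avoid_def first_passage_nonneg)
  have "\<exists>q. (\<lambda>n. avoid z n x) \<longlonglongrightarrow> q" for x
    using decseq_convergent[OF dec, of 0] avoid_nonneg by metis
  then obtain q where q: "\<And>x. (\<lambda>n. avoid z n x) \<longlonglongrightarrow> q x"
    by metis
  have q_nonneg: "0 \<le> q x" for x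
    using q[of x] by (rule LIMSEQ_le_const) (simp add: avoid_nonneg)
  have q_eq: "q x = (\<Sum>y\<in>UNIV - {z}. P x y * q y)" for x
  proof (rule LIMSEQ_unique)
    show "(\<lambda>n. avoid z (Suc n) x) \<longlonglongrightarrow> q x"
      using q by (rule LIMSEQ_Suc)
    show "(\<lambda>n. avoid z (Suc n) x) \<longlonglongrightarrow> (\<Sum>y\<in>UNIV - {z}. P x y * q y)"
      unfolding avoid_Suc by (intro tendsto_intros q)
  qed
  define C where "C = {y. accessible P z y}"
  have "z \<in> C"
    unfolding C_def by (simp add: accessible_refl)
  have C_step: "y \<in> C" if "x \<in> C" "P x y > 0" for x y
    using that accessible_step accessible_trans unfolding C_def by blast
  define m where "m = Max (q ` C)"
  have q_le: "q x \<le> m" if "x \<in> C" for x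
    unfolding m_def using that by simp
  have "m = 0"
  proof (rule ccontr)
    assume "m \<noteq> 0"
    then have "m > 0"
      using q_le[OF \<open>z \<in> C\<close>] q_nonneg[of z] by linarith
    define A where "A = {x \<in> C. q x = m}"
    have A_step: "y \<in> A \<and> y \<noteq> z" if "x \<in> A" "P x y > 0" for x y
    proof -
      have x: "x \<in> C" "q x = m"
        using that unfolding A_def by auto
      \<comment> \<open>The sum of \<open>u\<close> is \<open>m - q x = 0\<close> with nonnegative
        terms, so each term vanishes. Counting the value at \<open>z\<close> as 0 makes the factor
        there \<open>m > 0\<close>, which rules out a transition to \<open>z\<close>.\<close>
      define u where "u = (\<lambda>w. P x w * (m - (if w = z then 0 else q w)))"
      have "(\<Sum>w\<in>UNIV. P x w * (if w = z then 0 else q w)) = q x"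
        by (subst q_eq[of x], subst sum.remove[of _ z]) (auto intro!: sum.cong)
      then have "(\<Sum>w\<in>UNIV. u w) = 0"
        unfolding u_def by (simp add: right_diff_distrib sum_subtractf flip: sum_distrib_right)
          (simp add: x)
      moreover have "u w \<ge> 0" for w
      proof (cases "P x w = 0")
        case False
        then have "P x w > 0"
          using P_nonneg[of x w] by linarith
        then show ?thesis
          using q_le[OF C_step[OF x(1)]] \<open>m > 0\<close> unfolding u_def by auto
      qed (simp add: u_def)
      ultimately have "u y = 0"
        by (simp add: sum_nonneg_eq_0_iff)
      then show ?thesis
        using that \<open>m > 0\<close> C_step[OF x(1)] unfolding u_def A_def by (auto split: if_splits)
    qed
    have A_null: "n_step P (Suc n) x z = 0" if "x \<in> A" for n x
      using that
    proof (induction n arbitrary: x)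
      case 0
      then have "\<not> P x z > 0"
        using A_step by blast
      then have "P x z = 0"
        by (rule P_eq_0)
      then show ?case
        by (simp add: if_distrib[of "\<lambda>c. _ * c"] cong: if_cong)
    next
      case (Suc n)
      have "P x y * n_step P (Suc n) y z = 0" for y
      proof (cases "P x y > 0")
        case True
        then show ?thesis
          using Suc.IH A_step[OF Suc.prems] by simp
      next
        case False
        then show ?thesis
          by (simp add: P_eq_0)
      qed
      then show ?case
        by (subst n_step.simps(2)) (intro sum.neutral ballI)
    qed
    have "m \<in> q ` C"
      unfolding m_def using \<open>z \<in> C\<close> by (intro Max_in) auto
    then obtain x where "x \<in> A"
      unfolding A_def by auto
    \<comment> \<open>The maximiser \<open>x\<close> may be \<open>z\<close> itself. One step
      further lies a state of \<open>A\<close> other than \<open>z\<close>, which cannot reach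
      \<open>z\<close> at time 0 either.\<close>
    obtain y where "P x y > 0"
      using exists_successor by blast
    then have y: "y \<in> A" "y \<noteq> z"
      using A_step \<open>x \<in> A\<close> by auto
    then have "accessible P y z"
      using assms unfolding essential_def A_def C_def by blast
    then obtain n where "n_step P n y z > 0"
      unfolding accessible_def by blast
    then show False
      using A_null[OF y(1)] y(2) by (cases n) auto
  qed
  then have "q z = 0"
    using q_le[OF \<open>z \<in> C\<close>] q_nonneg[of z] by linarith
  then have "(\<lambda>n. 1 - avoid z n z) \<longlonglongrightarrow> 1 - 0"
    using q[of z] by (intro tendsto_diff) auto
  then show ?thesis
    unfolding recurrent_def sums_def avoid_def by simp
qed

text \<open>All essential states lie in the single recurrent class, so every state leads to a fixed
  essential \<open>z\<close>. By aperiodicity returns to \<open>z\<close> are possible at all large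
  times, which pads the different travel times to a common one.\<close>

lemma unichain_aperiodic_imp_n_step_pos:
  assumes "unichain P" "aperiodic P"
  shows "\<exists>N z. \<forall>x. n_step P N x z > 0"
proof -
  obtain C where C: "C \<in> recurrent_classes P" "\<And>C'. C' \<in> recurrent_classes P \<Longrightarrow> C' = C"
    using assms(1) unfolding unichain_def by blast
  have ess: "communicating_class P z = C" if "essential z" for z
    using C(2) essential_imp_recurrent[OF that] unfolding recurrent_classes_def by blast
  obtain z where z: "essential z"
    using exists_essential by blast
  have mem: "y \<in> C" if "essential y" for y
    using ess[OF that] accessible_refl unfolding communicating_class_def by blast
  have "accessible P x z" for x
  proof -
    obtain y where y: "accessible P x y" "essential y"
      using exists_essential by blast
    then have "y \<in> communicating_class P z"
      using ess[OF z] mem by simp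
    then show ?thesis
      using y(1) accessible_trans unfolding communicating_class_def by blast
  qed
  then obtain d where d: "\<And>x. n_step P (d x) x z > 0"
    unfolding accessible_def by metis
  have "period P z = 1"
    using assms(2) C(1) mem[OF z] unfolding aperiodic_def by blast
  \<comment> \<open>Adjoining 0 leaves the gcd unchanged and gives the additive set with zero that
    the number-theoretic lemma expects.\<close>
  moreover have "{n. n_step P n z z > 0} = insert 0 {n. n > 0 \<and> n_step P n z z > 0}"
    by auto
  ultimately have "Gcd {n. n_step P n z z > 0} = 1"
    unfolding period_def by (simp del: One_nat_def)
  then have "\<exists>m. \<forall>n\<ge>m. n \<in> {n. n_step P n z z > 0}"
    by (intro eventually_mem_if_Gcd_1) (auto intro: n_step_pos_trans)
  then obtain m where m: "\<And>n. n \<ge> m \<Longrightarrow> n_step P n z z > 0"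
    by auto
  have "n_step P (Max (range d) + m) x z > 0" for x
  proof -
    have "d x \<le> Max (range d)"
      by simp
    \<comment> \<open>The middle part is a return to \<open>z\<close> of length at least
      \<open>m\<close>.\<close>
    then have eq: "d x + (Max (range d) - d x + m) = Max (range d) + m"
      by linarith
    show ?thesis
      using n_step_pos_trans[OF d[of x] m[OF le_add2[of m "Max (range d) - d x"]]] unfolding eq .
  qed
  then show ?thesis by blast
qed


section \<open>Contraction of oscillations\<close>

text \<open>The matrix acting on functions: the expected value of \<open>f\<close> one step
  ahead.\<close>

definition trans_op :: "('s \<Rightarrow> real) \<Rightarrow> 's \<Rightarrow> real" where
  "trans_op f x = (\<Sum>y\<in>UNIV. P x y * f y)"

lemma trans_op_funpow: "(trans_op ^^ n) f x = (\<Sum>y\<in>UNIV. n_step P n x y * f y)"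
proof (induction n arbitrary: x)
  case 0
  then show ?case
    by (simp add: if_distrib[of "\<lambda>c. c * _"] cong: if_cong)
next
  case (Suc n)
  have "(trans_op ^^ Suc n) f x = (\<Sum>z\<in>UNIV. \<Sum>y\<in>UNIV. P x z * (n_step P n z y * f y))"
    by (simp add: trans_op_def Suc sum_distrib_left)
  also have "\<dots> = (\<Sum>y\<in>UNIV. \<Sum>z\<in>UNIV. P x z * (n_step P n z y * f y))"
    by (rule sum.swap)
  finally show ?case
    by (simp add: sum_distrib_right mult.assoc)
qed

lemma n_step_sum [simp]: "(\<Sum>y\<in>UNIV. n_step P n x y) = 1"
proof -
  have "(trans_op ^^ n) (\<lambda>_. 1) = (\<lambda>_. 1)"
    by (induction n) (auto simp: trans_op_def)
  then show ?thesis
    using trans_op_funpow[of n "\<lambda>_. 1" x] by simp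
qed

lemma trans_op_add: "trans_op (\<lambda>x. f x + h x) x = trans_op f x + trans_op h x"
  by (simp add: trans_op_def distrib_left sum.distrib)

lemma trans_op_bounds:
  assumes "\<And>x. f x \<in> {a..b}"
  shows "(trans_op ^^ n) f x \<in> {a..b}"
proof -
  have "(\<Sum>y\<in>UNIV. n_step P n x y * a) \<le> (\<Sum>y\<in>UNIV. n_step P n x y * f y)"
    "(\<Sum>y\<in>UNIV. n_step P n x y * f y) \<le> (\<Sum>y\<in>UNIV. n_step P n x y * b)"
    using assms by (auto intro!: sum_mono mult_left_mono)
  then show ?thesis
    by (simp add: trans_op_funpow flip: sum_distrib_right)
qed

text \<open>Doeblin's minorization: each row of the \<open>N\<close>-step matrix is mass
  \<open>\<delta>\<close> at \<open>z\<close> plus a nonnegative remainder \<open>w\<close> of mass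
  \<open>1 - \<delta>\<close>. The first part contributes the same for every \<open>x\<close>, so
  only the remainder spreads the values.\<close>

lemma trans_op_minorization_bounds:
  assumes f: "\<And>x. f x \<in> {a..b}" and \<delta>: "\<And>x. \<delta> \<le> n_step P N x z"
  shows "(trans_op ^^ N) f x \<in> {\<delta> * f z + (1 - \<delta>) * a .. \<delta> * f z + (1 - \<delta>) * b}"
proof -
  define w where "w = (\<lambda>y. n_step P N x y - (if y = z then \<delta> else 0))"
  have w: "0 \<le> w y" for y
    using \<delta>[of x] by (simp add: w_def)
  have w_sum: "(\<Sum>y\<in>UNIV. w y) = 1 - \<delta>"
    by (simp add: w_def sum_subtractf)
  have "(\<Sum>y\<in>UNIV. w y * a) \<le> (\<Sum>y\<in>UNIV. w y * f y)"
    "(\<Sum>y\<in>UNIV. w y * f y) \<le> (\<Sum>y\<in>UNIV. w y * b)"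
    using f w by (auto intro!: sum_mono mult_left_mono)
  moreover have "(\<Sum>y\<in>UNIV. w y * f y) = (trans_op ^^ N) f x - \<delta> * f z"
    by (simp add: w_def trans_op_funpow left_diff_distrib sum_subtractf
        if_distrib[of "\<lambda>c. c * _"] cong: if_cong)
  ultimately show ?thesis
    by (simp add: w_sum flip: sum_distrib_right)
qed

text \<open>Every block of \<open>N\<close> steps shrinks an interval containing all values by the
  factor \<open>1 - \<delta>\<close>, and averaging never leaves an interval. Hence the iterates are
  Cauchy at each state, with one limit for all states.\<close>

lemma trans_op_funpow_tendsto:
  assumes "unichain P" "aperiodic P"
  shows "\<exists>L. \<forall>x. (\<lambda>n. (trans_op ^^ n) f x) \<longlonglongrightarrow> L"
proof -
  obtain N z where Nz: "\<And>x. n_step P N x z > 0"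
    using unichain_aperiodic_imp_n_step_pos[OF assms] by blast
  define \<delta> where "\<delta> = Min (range (\<lambda>x. n_step P N x z))"
  have \<delta>_le: "\<delta> \<le> n_step P N x z" for x
    by (simp add: \<delta>_def)
  have "\<delta> > 0"
    using Nz by (simp add: \<delta>_def)
  have "n_step P N z z \<le> (\<Sum>y\<in>UNIV. n_step P N z y)"
    by (rule member_le_sum) auto
  then have "\<delta> \<le> 1"
    using \<delta>_le[of z] by simp
  define W where "W = Max (range f) - Min (range f)"
  have "\<exists>a b. b - a = (1 - \<delta>) ^ k * W \<and> (\<forall>x. (trans_op ^^ (k * N)) f x \<in> {a..b})" for k
  proof (induction k)
    case 0
    show ?case
      by (rule exI[of _ "Min (range f)"], rule exI[of _ "Max (range f)"]) (auto simp: W_def)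
  next
    case (Suc k)
    then obtain a b where ab: "b - a = (1 - \<delta>) ^ k * W"
      "\<And>x. (trans_op ^^ (k * N)) f x \<in> {a..b}"
      by blast
    define c where "c = \<delta> * (trans_op ^^ (k * N)) f z"
    have "(trans_op ^^ (Suc k * N)) f x \<in> {c + (1 - \<delta>) * a .. c + (1 - \<delta>) * b}" for x
      using trans_op_minorization_bounds[OF ab(2) \<delta>_le] by (simp add: funpow_add c_def)
    moreover have "(c + (1 - \<delta>) * b) - (c + (1 - \<delta>) * a) = (1 - \<delta>) ^ Suc k * W"
      using ab(1) by (simp add: right_diff_distrib[symmetric] mult.assoc)
    ultimately show ?case by blast
  qed
  then obtain a b where ab: "\<And>k. b k - a k = (1 - \<delta>) ^ k * W"
    "\<And>k x. (trans_op ^^ (k * N)) f x \<in> {a k..b k}"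
    by metis
  have lim: "(\<lambda>k. (1 - \<delta>) ^ k * W) \<longlonglongrightarrow> 0"
    using \<open>\<delta> > 0\<close> \<open>\<delta> \<le> 1\<close> by (intro tendsto_mult_left_zero LIMSEQ_power_zero) auto
  have small: "\<exists>k. b k - a k < e" if "e > 0" for e
    using order_tendstoD(2)[OF lim that] unfolding ab(1) eventually_sequentially by blast
  have tail: "(trans_op ^^ n) f x \<in> {a k..b k}" if "n \<ge> k * N" for n k x
  proof -
    \<comment> \<open>The steps after the first \<open>k * N\<close> only average values already in
      the interval.\<close>
    have "(trans_op ^^ n) f x = (trans_op ^^ (n - k * N)) ((trans_op ^^ (k * N)) f) x"
      using that by (simp flip: funpow_add[THEN fun_cong, unfolded comp_def])
    then show ?thesis
      using trans_op_bounds[OF ab(2)] by simp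
  qed
  have "Cauchy (\<lambda>n. (trans_op ^^ n) f x)" for x
  proof (rule metric_CauchyI)
    fix e :: real
    assume "e > 0"
    then obtain k where "b k - a k < e"
      using small by blast
    then have "dist ((trans_op ^^ m) f x) ((trans_op ^^ n) f x) < e" if "m \<ge> k * N" "n \<ge> k * N" for m n
      using tail[OF that(1), of x] tail[OF that(2), of x] by (auto simp: dist_real_def)
    then show "\<exists>M. \<forall>m\<ge>M. \<forall>n\<ge>M. dist ((trans_op ^^ m) f x) ((trans_op ^^ n) f x) < e"
      by blast
  qed
  then obtain l where l: "\<And>x. (\<lambda>n. (trans_op ^^ n) f x) \<longlonglongrightarrow> l x"
    unfolding Cauchy_convergent_iff convergent_def by metis
  have l_bounds: "l x \<in> {a k..b k}" for x k
    by (rule closed_sequentially[OF closed_atLeastAtMost _ LIMSEQ_ignore_initial_segment[OF l[of x]]])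
      (rule tail, rule le_add2)
  have "l x = l y" for x y
  proof (rule ccontr)
    assume "l x \<noteq> l y"
    then obtain k where "b k - a k < \<bar>l x - l y\<bar>"
      using small[of "\<bar>l x - l y\<bar>"] by auto
    then show False
      using l_bounds[of x k] l_bounds[of y k] by auto
  qed
  then show ?thesis
    using l by metis
qed

end


section \<open>Bounded orthogonal differences\<close>

text \<open>Borel-Cantelli for each threshold \<open>1 / (m + 1)\<close>; countably many thresholds
  leave one null set.\<close>

lemma (in prob_space) AE_tendsto_0_if_summable:
  fixes Y :: "nat \<Rightarrow> 'a \<Rightarrow> real"
  assumes [measurable]: "\<And>k. Y k \<in> borel_measurable M"
    and sum: "\<And>\<epsilon>. \<epsilon> > 0 \<Longrightarrow> summable (\<lambda>k. prob {\<omega> \<in> space M. \<epsilon> \<le> \<bar>Y k \<omega>\<bar>})"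
  shows "AE \<omega> in M. (\<lambda>k. Y k \<omega>) \<longlonglongrightarrow> 0"
proof -
  have "AE \<omega> in M. \<forall>m. \<forall>\<^sub>F k in sequentially. \<bar>Y k \<omega>\<bar> < inverse (real (Suc m))"
    unfolding AE_all_countable
  proof
    fix m
    let ?A = "\<lambda>k. {\<omega> \<in> space M. inverse (real (Suc m)) \<le> \<bar>Y k \<omega>\<bar>}"
    have "AE \<omega> in M. \<forall>\<^sub>F k in sequentially. \<omega> \<in> space M - ?A k"
      by (rule borel_cantelli_AE1[OF _ _ sum]) (auto simp: emeasure_eq_measure)
    then show "AE \<omega> in M. \<forall>\<^sub>F k in sequentially. \<bar>Y k \<omega>\<bar> < inverse (real (Suc m))"
      by eventually_elim (auto elim: eventually_mono)
  qed
  then show ?thesis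
  proof eventually_elim
    case (elim \<omega>)
    show ?case
    proof (rule tendstoI)
      fix e :: real
      assume "e > 0"
      then obtain m where "inverse (real (Suc m)) < e"
        using reals_Archimedean by blast
      then show "\<forall>\<^sub>F k in sequentially. dist (Y k \<omega>) 0 < e"
        using elim[rule_format, of m] by (auto elim: eventually_mono)
    qed
  qed
qed

text \<open>The term linear in \<open>d\<close> is kept because its expectation will vanish by
  orthogonality; the term \<open>4 * s * d ^ 3\<close> is absorbed through
  \<open>2 * s * d \<le> s\<^sup>2 + d\<^sup>2\<close>.\<close>

lemma fourth_power_add_le:
  fixes s d K :: real
  assumes "\<bar>d\<bar> \<le> K"
  shows "(s + d) ^ 4 \<le> s ^ 4 + 4 * (s ^ 3 * d) + 8 * K\<^sup>2 * s\<^sup>2 + 3 * K ^ 4"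
proof -
  have d2: "d\<^sup>2 \<le> K\<^sup>2"
    using assms by (simp add: abs_le_square_iff[symmetric])
  have "2 * (s * d) \<le> s\<^sup>2 + d\<^sup>2"
    using sum_squares_bound[of s d] by (simp add: mult.assoc)
  then have "2 * d\<^sup>2 * (2 * (s * d)) \<le> 2 * d\<^sup>2 * (s\<^sup>2 + d\<^sup>2)"
    by (intro mult_left_mono) auto
  then have "(s + d) ^ 4 \<le> s ^ 4 + 4 * (s ^ 3 * d) + 8 * d\<^sup>2 * s\<^sup>2 + 3 * (d\<^sup>2)\<^sup>2"
    by (simp add: eval_nat_numeral algebra_simps)
  also have "\<dots> \<le> s ^ 4 + 4 * (s ^ 3 * d) + 8 * K\<^sup>2 * s\<^sup>2 + 3 * (K\<^sup>2)\<^sup>2"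
    using mult_right_mono[OF d2, of "s\<^sup>2"] power_mono[OF d2, of 2] by simp
  finally show ?thesis by simp
qed

text \<open>Orthogonality keeps the second moments of the partial sums of order \<open>T\<close> and
  thus the fourth moments of order \<open>T\<^sup>2\<close>, so deviations of the average have
  probability of order \<open>1 / T\<^sup>2\<close>, which is summable. Second moments alone would
  give only \<open>1 / T\<close>.\<close>

lemma (in prob_space) AE_average_tendsto_0:
  fixes D :: "nat \<Rightarrow> 'a \<Rightarrow> real"
  assumes [measurable]: "\<And>k. D k \<in> borel_measurable M"
    and K: "\<And>k \<omega>. \<bar>D k \<omega>\<bar> \<le> K"
    and orth1: "\<And>k. expectation (\<lambda>\<omega>. (\<Sum>i<k. D i \<omega>) * D k \<omega>) = 0"
    and orth3: "\<And>k. expectation (\<lambda>\<omega>. (\<Sum>i<k. D i \<omega>) ^ 3 * D k \<omega>) = 0"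
  shows "AE \<omega> in M. (\<lambda>T. (\<Sum>i<T. D i \<omega>) / real T) \<longlonglongrightarrow> 0"
proof -
  define S where "S = (\<lambda>T \<omega>. \<Sum>i<T. D i \<omega>)"
  have [measurable]: "S T \<in> borel_measurable M" for T
    unfolding S_def by measurable
  have S_bound: "\<bar>S T \<omega>\<bar> \<le> real T * K" for T \<omega>
    unfolding S_def using sum_norm_bound[of "{..<T}" "\<lambda>i. D i \<omega>" K] K by simp
  have int: "integrable M (\<lambda>\<omega>. S T \<omega> ^ m * D T \<omega> ^ n)" for T m n
  proof (rule integrable_const_bound)
    show "AE \<omega> in M. norm (S T \<omega> ^ m * D T \<omega> ^ n) \<le> (real T * K) ^ m * K ^ n"
      using S_bound K order_trans[OF abs_ge_zero S_bound]
      by (intro AE_I2) (auto simp: abs_mult power_abs intro!: mult_mono power_mono)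
  qed measurable
  note int_S = int[of _ _ 0, simplified] and int_SD = int[of _ _ 1, simplified]
  have S_Suc: "S (Suc T) \<omega> = S T \<omega> + D T \<omega>" for T \<omega>
    by (simp add: S_def)
  have orth: "expectation (\<lambda>\<omega>. S T \<omega> * D T \<omega>) = 0" "expectation (\<lambda>\<omega>. S T \<omega> ^ 3 * D T \<omega>) = 0" for T
    using orth1 orth3 by (simp_all add: S_def)
  have mom2: "expectation (\<lambda>\<omega>. (S T \<omega>)\<^sup>2) \<le> K\<^sup>2 * real T" for T
  proof (induction T)
    case 0
    then show ?case by (simp add: S_def)
  next
    case (Suc T)
    have "expectation (\<lambda>\<omega>. (S (Suc T) \<omega>)\<^sup>2)
        \<le> expectation (\<lambda>\<omega>. (S T \<omega>)\<^sup>2 + 2 * (S T \<omega> * D T \<omega>) + K\<^sup>2)"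
    proof (rule integral_mono[OF int_S])
      show "integrable M (\<lambda>\<omega>. (S T \<omega>)\<^sup>2 + 2 * (S T \<omega> * D T \<omega>) + K\<^sup>2)"
        using int_S[of T 2] int_SD[of T 1] by simp
      show "(S (Suc T) \<omega>)\<^sup>2 \<le> (S T \<omega>)\<^sup>2 + 2 * (S T \<omega> * D T \<omega>) + K\<^sup>2" for \<omega>
        using K[of T \<omega>] by (simp add: S_Suc power2_sum abs_le_square_iff[symmetric])
    qed
    also have "\<dots> = expectation (\<lambda>\<omega>. (S T \<omega>)\<^sup>2) + K\<^sup>2"
      using int_S[of T 2] int_SD[of T 1] orth by (simp add: prob_space)
    finally show ?case
      using Suc by (simp add: algebra_simps)
  qed
  have mom4: "expectation (\<lambda>\<omega>. S T \<omega> ^ 4) \<le> 4 * K ^ 4 * (real T)\<^sup>2" for T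
  proof (induction T)
    case 0
    then show ?case by (simp add: S_def)
  next
    case (Suc T)
    have "expectation (\<lambda>\<omega>. S (Suc T) \<omega> ^ 4)
        \<le> expectation (\<lambda>\<omega>. S T \<omega> ^ 4 + 4 * (S T \<omega> ^ 3 * D T \<omega>) + 8 * K\<^sup>2 * (S T \<omega>)\<^sup>2 + 3 * K ^ 4)"
    proof (rule integral_mono[OF int_S])
      show "integrable M (\<lambda>\<omega>. S T \<omega> ^ 4 + 4 * (S T \<omega> ^ 3 * D T \<omega>) + 8 * K\<^sup>2 * (S T \<omega>)\<^sup>2 + 3 * K ^ 4)"
        using int_S[of T 2] int_S[of T 4] int_SD[of T 3] by simp
    qed (simp add: S_Suc fourth_power_add_le[OF K])
    also have "\<dots> = expectation (\<lambda>\<omega>. S T \<omega> ^ 4) + 8 * K\<^sup>2 * expectation (\<lambda>\<omega>. (S T \<omega>)\<^sup>2) + 3 * K ^ 4"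
      using int_S[of T 2] int_S[of T 4] int_SD[of T 3] orth by (simp add: prob_space)
    also have "\<dots> \<le> 4 * K ^ 4 * (real T)\<^sup>2 + 8 * K\<^sup>2 * (K\<^sup>2 * real T) + 3 * K ^ 4"
      using Suc mom2[of T] by (intro add_mono mult_left_mono) auto
    \<comment> \<open>The constant 4 closes the induction: the increment \<open>8 * T + 3\<close> is
      at most \<open>4 * (2 * T + 1)\<close>.\<close>
    also have "\<dots> \<le> 4 * K ^ 4 * (real (Suc T))\<^sup>2"
      using zero_le_square[of "K * K"] by (simp add: eval_nat_numeral algebra_simps)
    finally show ?case .
  qed
  have "AE \<omega> in M. (\<lambda>T. S T \<omega> / real T) \<longlonglongrightarrow> 0"
  proof (rule AE_tendsto_0_if_summable)
    fix \<epsilon> :: real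
    assume "\<epsilon> > 0"
    show "summable (\<lambda>T. prob {\<omega> \<in> space M. \<epsilon> \<le> \<bar>S T \<omega> / real T\<bar>})"
    proof (rule summable_comparison_test'[where N = 1])
      show "summable (\<lambda>T. 4 * K ^ 4 / \<epsilon> ^ 4 * inverse (real T ^ 2))"
        by (intro summable_mult inverse_power_summable) auto
      fix T :: nat
      assume "T \<ge> 1"
      \<comment> \<open>Squaring the event lets the second moment bound, applied to the square of
        \<open>S T\<close>, yield the fourth moment.\<close>
      have "{\<omega> \<in> space M. \<epsilon> \<le> \<bar>S T \<omega> / real T\<bar>} = {\<omega> \<in> space M. (\<epsilon> * real T)\<^sup>2 \<le> \<bar>(S T \<omega>)\<^sup>2\<bar>}"
        using \<open>\<epsilon> > 0\<close> \<open>T \<ge> 1\<close> by (auto simp: pos_le_divide_eq abs_le_square_iff[symmetric] abs_mult)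
      then have "prob {\<omega> \<in> space M. \<epsilon> \<le> \<bar>S T \<omega> / real T\<bar>}
          \<le> expectation (\<lambda>\<omega>. ((S T \<omega>)\<^sup>2)\<^sup>2) / ((\<epsilon> * real T)\<^sup>2)\<^sup>2"
        using \<open>\<epsilon> > 0\<close> \<open>T \<ge> 1\<close> int_S[of T 4] by (simp only:) (rule second_moment_method, auto)
      also have "\<dots> \<le> 4 * K ^ 4 * (real T)\<^sup>2 / ((\<epsilon> * real T)\<^sup>2)\<^sup>2"
        using mom4[of T] by (intro divide_right_mono) auto
      also have "\<dots> = 4 * K ^ 4 / \<epsilon> ^ 4 * inverse (real T ^ 2)"
        using \<open>\<epsilon> > 0\<close> \<open>T \<ge> 1\<close> by (simp add: field_simps eval_nat_numeral)
      finally show "norm (prob {\<omega> \<in> space M. \<epsilon> \<le> \<bar>S T \<omega> / real T\<bar>})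
          \<le> 4 * K ^ 4 / \<epsilon> ^ 4 * inverse (real T ^ 2)"
        by simp
    qed
  qed measurable
  then show ?thesis
    by (simp add: S_def)
qed


section \<open>The ergodic theorem for the chain\<close>

locale markov_process = stochastic_matrix P + prob_space M
  for P :: "'s::finite \<Rightarrow> 's \<Rightarrow> real" and M :: "'w measure" +
  fixes X :: "nat \<Rightarrow> 'w \<Rightarrow> 's" and \<mu>\<^sub>0 :: "'s pmf"
  assumes markov_chain: "markov_chain M X P \<mu>\<^sub>0"
begin

section \<open>Finite histories and the Markov property\<close>

lemma measurable_X [measurable]: "X t \<in> measurable M (count_space UNIV)"
  using markov_chain unfolding markov_chain_def by blast

text \<open>A list of length \<open>t + 1\<close> takes finitely many values, so conditioning on the
  past reduces to finite sums over lists.\<close>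

definition history :: "nat \<Rightarrow> 'w \<Rightarrow> 's list" where
  "history t \<omega> = map (\<lambda>s. X s \<omega>) [0..<Suc t]"

lemma length_history [simp]: "length (history t \<omega>) = Suc t"
  by (simp add: history_def)

lemma nth_history: "s \<le> t \<Longrightarrow> history t \<omega> ! s = X s \<omega>"
  by (simp add: history_def nth_append del: upt_Suc)

lemma history_eq_iff: "length l = Suc t \<Longrightarrow> history t \<omega> = l \<longleftrightarrow> (\<forall>s\<le>t. X s \<omega> = l ! s)"
  by (auto simp: list_eq_iff_nth_eq nth_history less_Suc_eq_le)

lemma finite_histories: "finite {l :: 's list. length l = n}"
  using finite_lists_length_eq[of "UNIV :: 's set" n] by simp

lemma sets_history: "{\<omega> \<in> space M. history t \<omega> = l} \<in> sets M"
proof (cases "length l = Suc t")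
  case True
  then show ?thesis
    unfolding history_eq_iff[OF True] by measurable
next
  case False
  then have "{\<omega> \<in> space M. history t \<omega> = l} = {}"
    by auto
  then show ?thesis
    by (simp only: sets.empty_sets)
qed

lemma sets_history_next: "{\<omega> \<in> space M. history t \<omega> = l \<and> X (Suc t) \<omega> = y} \<in> sets M"
proof -
  have "{\<omega> \<in> space M. history t \<omega> = l \<and> X (Suc t) \<omega> = y}
      = {\<omega> \<in> space M. history t \<omega> = l} \<inter> {\<omega> \<in> space M. X (Suc t) \<omega> = y}"
    by auto
  also have "\<dots> \<in> sets M"
    by (intro sets.Int sets_history) measurable
  finally show ?thesis .
qed

text \<open>The Markov property in product form. It also covers histories of probability zero, about
  which \<open>markov_chain\<close> says nothing: there both sides vanish.\<close>

lemma prob_history_next: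
  assumes l: "length l = Suc t"
  shows "prob {\<omega> \<in> space M. history t \<omega> = l \<and> X (Suc t) \<omega> = y}
    = prob {\<omega> \<in> space M. history t \<omega> = l} * P (l ! t) y"
proof (cases "prob {\<omega> \<in> space M. history t \<omega> = l} > 0")
  case True
  then have "\<P>(\<omega> in M. X (Suc t) \<omega> = y \<bar> \<forall>s\<le>t. X s \<omega> = l ! s) = P (l ! t) y"
    using markov_chain unfolding markov_chain_def history_eq_iff[OF l] by blast
  then show ?thesis
    using True unfolding cond_prob_def history_eq_iff[OF l]
    by (simp add: field_simps conj_commute)
next
  case False
  then have 0: "prob {\<omega> \<in> space M. history t \<omega> = l} = 0"
    by (simp add: zero_less_measure_iff)
  moreover have "prob {\<omega> \<in> space M. history t \<omega> = l \<and> X (Suc t) \<omega> = y}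
      \<le> prob {\<omega> \<in> space M. history t \<omega> = l}"
    by (rule finite_measure_mono[OF _ sets_history]) auto
  ultimately show ?thesis
    using measure_nonneg[of M "{\<omega> \<in> space M. history t \<omega> = l \<and> X (Suc t) \<omega> = y}"] by simp
qed

lemma expectation_history:
  fixes F :: "'s list \<Rightarrow> real"
  shows "expectation (\<lambda>\<omega>. F (history t \<omega>))
    = (\<Sum>l | length l = Suc t. F l * prob {\<omega> \<in> space M. history t \<omega> = l})"
proof -
  have "expectation (\<lambda>\<omega>. F (history t \<omega>)) = expectation (\<lambda>\<omega>. \<Sum>l | length l = Suc t.
      F l * indicator {\<omega> \<in> space M. history t \<omega> = l} \<omega>)"
    by (rule Bochner_Integration.integral_cong)
      (auto simp: indicator_def finite_histories if_distrib[of "\<lambda>c. _ * c"] cong: if_cong)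
  then show ?thesis
    using sets_history by (simp add: integral_sum emeasure_eq_measure)
qed

text \<open>The integrated Markov property: against any function of the past, a transition function
  may be replaced by its mean over the next state.\<close>

lemma expectation_history_next:
  fixes F :: "'s list \<Rightarrow> real" and u :: "'s \<times> 's \<Rightarrow> real"
  shows "expectation (\<lambda>\<omega>. F (history t \<omega>) * u (X t \<omega>, X (Suc t) \<omega>))
    = expectation (\<lambda>\<omega>. F (history t \<omega>) * trans_op (\<lambda>y. u (X t \<omega>, y)) (X t \<omega>))"
proof -
  let ?A = "\<lambda>l y. {\<omega> \<in> space M. history t \<omega> = l \<and> X (Suc t) \<omega> = y}"
  \<comment> \<open>Exactly one pair of a history \<open>l\<close> and a next state \<open>y\<close>
    contributes to the double sum.\<close>
  have *: "F (history t \<omega>) * u (X t \<omega>, X (Suc t) \<omega>)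
      = (\<Sum>l | length l = Suc t. \<Sum>y\<in>UNIV. F l * u (l ! t, y) * indicator (?A l y) \<omega>)"
    if "\<omega> \<in> space M" for \<omega>
  proof -
    have "(\<Sum>l | length l = Suc t. \<Sum>y\<in>UNIV. F l * u (l ! t, y) * indicator (?A l y) \<omega>)
        = (\<Sum>l | length l = Suc t. if history t \<omega> = l then F l * u (l ! t, X (Suc t) \<omega>) else 0)"
    proof (rule sum.cong[OF refl])
      fix l
      have "(\<Sum>y\<in>UNIV. F l * u (l ! t, y) * indicator (?A l y) \<omega>)
          = (\<Sum>y\<in>UNIV. if X (Suc t) \<omega> = y then
              (if history t \<omega> = l then F l * u (l ! t, y) else 0) else 0)"
        using that by (intro sum.cong) (auto simp: indicator_def)
      then show "(\<Sum>y\<in>UNIV. F l * u (l ! t, y) * indicator (?A l y) \<omega>)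
          = (if history t \<omega> = l then F l * u (l ! t, X (Suc t) \<omega>) else 0)"
        by simp
    qed
    then show ?thesis
      by (simp add: finite_histories nth_history)
  qed
  have "expectation (\<lambda>\<omega>. F (history t \<omega>) * u (X t \<omega>, X (Suc t) \<omega>))
      = expectation (\<lambda>\<omega>. \<Sum>l | length l = Suc t. \<Sum>y\<in>UNIV. F l * u (l ! t, y) * indicator (?A l y) \<omega>)"
    by (rule Bochner_Integration.integral_cong[OF refl *])
  also have "\<dots> = (\<Sum>l | length l = Suc t. \<Sum>y\<in>UNIV. F l * u (l ! t, y) * prob (?A l y))"
    using sets_history_next by (simp add: integral_sum integrable_sum emeasure_eq_measure del: sum_mult_indicator)
  also have "\<dots> = (\<Sum>l | length l = Suc t. (F l * trans_op (\<lambda>y. u (l ! t, y)) (l ! t))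
      * prob {\<omega> \<in> space M. history t \<omega> = l})"
    by (intro sum.cong refl) (auto simp: prob_history_next trans_op_def sum_distrib_left
        sum_distrib_right mult_ac intro!: sum.cong)
  also have "\<dots> = expectation (\<lambda>\<omega>. F (history t \<omega>) *
      trans_op (\<lambda>y. u (history t \<omega> ! t, y)) (history t \<omega> ! t))"
    by (rule expectation_history[symmetric])
  finally show ?thesis
    by (simp add: nth_history)
qed

text \<open>The last step is integrated out first, replacing \<open>f\<close> by
  \<open>trans_op f\<close>; hence \<open>f\<close> is generalised in the induction.\<close>

lemma expectation_X: "expectation (\<lambda>\<omega>. f (X t \<omega>)) = measure_pmf.expectation \<mu>\<^sub>0 ((trans_op ^^ t) f)"
proof (induction t arbitrary: f)
  case 0
  have "distr M (count_space UNIV) (X 0) = measure_pmf \<mu>\<^sub>0"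
    using markov_chain unfolding markov_chain_def by blast
  then show ?case
    using integral_distr[OF measurable_X[of 0], of f] by simp
next
  case (Suc t)
  have "expectation (\<lambda>\<omega>. f (X (Suc t) \<omega>)) = expectation (\<lambda>\<omega>. trans_op f (X t \<omega>))"
    using expectation_history_next[of "\<lambda>_. 1" t "\<lambda>(x, y). f y"] by simp
  then show ?case
    using Suc[of "trans_op f"] by (simp add: funpow_swap1)
qed

lemma expectation_transition:
  "expectation (\<lambda>\<omega>. g (X t \<omega>, X (Suc t) \<omega>))
    = measure_pmf.expectation \<mu>\<^sub>0 ((trans_op ^^ t) (\<lambda>x. trans_op (\<lambda>y. g (x, y)) x))"
  using expectation_history_next[of "\<lambda>_. 1" t g] by (simp add: expectation_X[symmetric])

lemma measurable_transition [measurable]: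
  "(\<lambda>\<omega>. g (X t \<omega>, X (Suc t) \<omega>) :: real) \<in> borel_measurable M"
  by measurable

text \<open>Given the past, each term has mean zero, so it is orthogonal to every power of the
  preceding partial sum, that sum being a function of the history.\<close>

lemma AE_average_centred_tendsto_0:
  fixes G :: "'s \<times> 's \<Rightarrow> real"
  assumes "\<And>x. trans_op (\<lambda>y. G (x, y)) x = 0"
  shows "AE \<omega> in M. (\<lambda>T. (\<Sum>t<T. G (X t \<omega>, X (Suc t) \<omega>)) / real T) \<longlonglongrightarrow> 0"
proof (rule AE_average_tendsto_0)
  show "\<bar>G (X t \<omega>, X (Suc t) \<omega>)\<bar> \<le> Max (range (\<lambda>p. \<bar>G p\<bar>))" for t \<omega>
    by (intro Max_ge) auto
  have orth: "expectation (\<lambda>\<omega>. (\<Sum>i<t. G (X i \<omega>, X (Suc i) \<omega>)) ^ m * G (X t \<omega>, X (Suc t) \<omega>)) = 0" for t m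
  proof -
    define F where "F = (\<lambda>l. (\<Sum>i<t. G (l ! i, l ! Suc i)) ^ m)"
    have "(\<Sum>i<t. G (X i \<omega>, X (Suc i) \<omega>)) ^ m = F (history t \<omega>)" for \<omega>
      by (simp add: F_def nth_history)
    then show ?thesis
      using expectation_history_next[of F t G] assms by simp
  qed
  show "expectation (\<lambda>\<omega>. (\<Sum>i<t. G (X i \<omega>, X (Suc i) \<omega>)) * G (X t \<omega>, X (Suc t) \<omega>)) = 0" for t
    using orth[of t 1] by simp
  show "expectation (\<lambda>\<omega>. (\<Sum>i<t. G (X i \<omega>, X (Suc i) \<omega>)) ^ 3 * G (X t \<omega>, X (Suc t) \<omega>)) = 0" for t
    by (rule orth)
qed measurable

text \<open>With \<open>h = f + P f + \<dots> + P\<^sup>m\<^sup>-\<^sup>1 f\<close>, where \<open>f\<close> is the expected one-step reward, the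
  truncated Poisson equation \<open>f - h + P h = P\<^sup>m f\<close> splits the reward into a centred transition
  function, a telescoping term and \<open>P\<^sup>m f\<close>, which is uniformly close to \<open>L\<close>.\<close>

lemma AE_average_tendsto:
  fixes g :: "'s \<times> 's \<Rightarrow> real"
  defines "f \<equiv> \<lambda>x. trans_op (\<lambda>y. g (x, y)) x"
  assumes L: "\<And>x. (\<lambda>n. (trans_op ^^ n) f x) \<longlonglongrightarrow> L"
  shows "AE \<omega> in M. (\<lambda>T. (\<Sum>t<T. g (X t \<omega>, X (Suc t) \<omega>)) / real T) \<longlonglongrightarrow> L"
proof -
  define h where "h = (\<lambda>m x. \<Sum>n<m. (trans_op ^^ n) f x)"
  have h_eq: "trans_op (h m) x = h m x - f x + (trans_op ^^ m) f x" for m x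
  proof (induction m)
    case 0
    then show ?case by (simp add: h_def trans_op_def)
  next
    case (Suc m)
    have "trans_op (h (Suc m)) x = trans_op (h m) x + trans_op ((trans_op ^^ m) f) x"
      unfolding trans_op_add[symmetric] by (simp add: h_def)
    then show ?case
      using Suc by (simp add: h_def)
  qed
  define G where "G = (\<lambda>m (x, y). g (x, y) - f x + h m y - trans_op (h m) x)"
  have "trans_op (\<lambda>y. G m (x, y)) x = 0" for m x
    by (simp add: G_def f_def trans_op_def algebra_simps sum.distrib sum_subtractf
        flip: sum_distrib_left sum_distrib_right)
  \<comment> \<open>One null set serves all truncation levels \<open>m\<close>, so that
    \<open>m\<close> can be chosen after \<open>\<omega>\<close> and the tolerance.\<close>
  then have "AE \<omega> in M. \<forall>m. (\<lambda>T. (\<Sum>t<T. G m (X t \<omega>, X (Suc t) \<omega>)) / real T) \<longlonglongrightarrow> 0"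
    unfolding AE_all_countable by (intro allI AE_average_centred_tendsto_0)
  then show ?thesis
  proof eventually_elim
    case (elim \<omega>)
    show ?case
    proof (rule tendstoI)
      fix e :: real
      assume "e > 0"
      have "\<forall>\<^sub>F m in sequentially. \<forall>x\<in>UNIV. \<bar>(trans_op ^^ m) f x - L\<bar> < e / 2"
        using tendstoD[OF L, of "e / 2"] \<open>e > 0\<close>
        by (intro eventually_ball_finite) (auto simp: dist_real_def)
      then obtain m where m: "\<And>x. \<bar>(trans_op ^^ m) f x - L\<bar> < e / 2"
        by (auto simp: eventually_sequentially)
      define B where "B = Max (range (\<lambda>x. \<bar>h m x\<bar>))"
      have B: "\<bar>h m x\<bar> \<le> B" for x
        unfolding B_def by (intro Max_ge) auto
      \<comment> \<open>The centred average plus a bound for the two boundary values of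
        \<open>h m\<close> that survive telescoping; the error of \<open>P\<^sup>m f\<close> takes
        the other half of \<open>e\<close>.\<close>
      define R where "R = (\<lambda>T. \<bar>(\<Sum>t<T. G m (X t \<omega>, X (Suc t) \<omega>)) / real T\<bar> + 2 * B / real T)"
      have "R \<longlonglongrightarrow> 0 + 0"
        unfolding R_def
        by (intro tendsto_add tendsto_rabs_zero elim[rule_format] lim_const_over_n)
      then have "\<forall>\<^sub>F T in sequentially. R T < e / 2"
        using order_tendstoD(2)[of R 0 sequentially "e / 2"] \<open>e > 0\<close> by simp
      then show "\<forall>\<^sub>F T in sequentially. dist ((\<Sum>t<T. g (X t \<omega>, X (Suc t) \<omega>)) / real T) L < e"
        using eventually_gt_at_top[of 0]
      proof eventually_elim
        case (elim T)
        have g_eq: "g (X t \<omega>, X (Suc t) \<omega>) - L = G m (X t \<omega>, X (Suc t) \<omega>)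
            + ((trans_op ^^ m) f (X t \<omega>) - L) - (h m (X (Suc t) \<omega>) - h m (X t \<omega>))" for t
          by (simp add: G_def h_eq)
        have "(\<Sum>t<T. g (X t \<omega>, X (Suc t) \<omega>)) / real T - L
            = (\<Sum>t<T. g (X t \<omega>, X (Suc t) \<omega>) - L) / real T"
          using elim(2) by (simp add: sum_subtractf field_simps)
        also have "(\<Sum>t<T. g (X t \<omega>, X (Suc t) \<omega>) - L) = (\<Sum>t<T. G m (X t \<omega>, X (Suc t) \<omega>))
            + (\<Sum>t<T. (trans_op ^^ m) f (X t \<omega>) - L) - (h m (X T \<omega>) - h m (X 0 \<omega>))"
          using sum_lessThan_telescope[of "\<lambda>t. h m (X t \<omega>)" T]
          by (simp add: g_eq sum_subtractf sum.distrib)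
        also have "\<dots> / real T = (\<Sum>t<T. G m (X t \<omega>, X (Suc t) \<omega>)) / real T
            + (\<Sum>t<T. (trans_op ^^ m) f (X t \<omega>) - L) / real T
            - (h m (X T \<omega>) - h m (X 0 \<omega>)) / real T"
          by (simp add: add_divide_distrib diff_divide_distrib)
        finally have eq: "(\<Sum>t<T. g (X t \<omega>, X (Suc t) \<omega>)) / real T - L = \<dots>" .
        have "\<bar>\<Sum>t<T. (trans_op ^^ m) f (X t \<omega>) - L\<bar> \<le> real T * (e / 2)"
          using sum_norm_bound[of "{..<T}" "\<lambda>t. (trans_op ^^ m) f (X t \<omega>) - L" "e / 2"]
            less_imp_le[OF m] by simp
        then have "\<bar>(\<Sum>t<T. (trans_op ^^ m) f (X t \<omega>) - L) / real T\<bar> \<le> e / 2"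
          using elim(2) by (simp add: field_simps)
        moreover have "\<bar>(h m (X T \<omega>) - h m (X 0 \<omega>)) / real T\<bar> \<le> 2 * B / real T"
          using B[of "X T \<omega>"] B[of "X 0 \<omega>"] by (simp add: divide_right_mono)
        ultimately show ?case
          using elim(1) unfolding dist_real_def eq R_def by linarith
      qed
    qed
  qed
qed

end

theorem theorem4p2:
  fixes P :: "'s::finite \<Rightarrow> 's \<Rightarrow> real"
    and g :: "'s \<times> 's \<Rightarrow> real"
    and \<mu>\<^sub>0 :: "'s pmf"
    and M :: "'w measure"
    and X :: "nat \<Rightarrow> nat \<Rightarrow> 'w \<Rightarrow> 's"
  assumes "transition_matrix P"
    and "unichain P"
    and "aperiodic P"
    and "independent_realizations M X P \<mu>\<^sub>0"
  shows "asymptotically_ergodic M (reward g X)"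
proof -
  have chain: "markov_chain M (X j) P \<mu>\<^sub>0" for j
    using assms(4) unfolding independent_realizations_def by blast
  interpret stochastic_matrix P
    by unfold_locales fact
  interpret prob_space M
    using chain unfolding markov_chain_def by blast
  interpret mp: markov_process P M "X j" \<mu>\<^sub>0 for j
    by unfold_locales (rule chain)
  define f where "f = (\<lambda>x. trans_op (\<lambda>y. g (x, y)) x)"
  obtain L where L: "\<And>x. (\<lambda>n. (trans_op ^^ n) f x) \<longlonglongrightarrow> L"
    using trans_op_funpow_tendsto[OF assms(2,3)] by blast
  \<comment> \<open>Sums from 0 to \<open>N\<close> have \<open>N + 1\<close> terms but are divided
    by \<open>N\<close>; this factor corrects both averages.\<close>
  have ratio: "(\<lambda>n. real (Suc n) / real n) \<longlonglongrightarrow> 1"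
    by real_asymp
  define e where "e = (\<lambda>t. measure_pmf.expectation \<mu>\<^sub>0 ((trans_op ^^ t) f))"
  have e_reward: "expectation (\<lambda>\<omega>. reward g X j t \<omega>) = e t" for j t
    unfolding reward_def e_def f_def by (rule mp.expectation_transition)
  have "e \<longlonglongrightarrow> (\<Sum>x\<in>UNIV. L * pmf \<mu>\<^sub>0 x)"
    unfolding e_def by (subst integral_measure_pmf_real[of UNIV]) (auto intro!: tendsto_intros L)
  then have e_lim: "e \<longlonglongrightarrow> L"
    by (simp add: sum_pmf_eq_1 flip: sum_distrib_left)
  \<comment> \<open>Each reward at time \<open>t\<close> is a measurable function of a whole
    trajectory, so independence of the trajectories carries over.\<close>
  have indep: "indep_vars (\<lambda>_. borel) (\<lambda>j. reward g X j t) I" for t I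
  proof -
    have "indep_vars (\<lambda>_. Pi\<^sub>M UNIV (\<lambda>_. count_space UNIV)) (\<lambda>j \<omega> t. X j t \<omega>) I"
      using assms(4) indep_vars_subset unfolding independent_realizations_def by blast
    then have "indep_vars (\<lambda>_. borel) (\<lambda>j \<omega>. (\<lambda>p. g (p t, p (Suc t))) (\<lambda>t. X j t \<omega>)) I"
      by (rule indep_vars_compose2) measurable
    then show ?thesis
      by (simp add: reward_def[abs_def])
  qed
  \<comment> \<open>The added 1 keeps \<open>K\<close> positive even when \<open>g\<close> vanishes
    identically.\<close>
  define K where "K = Max (range (\<lambda>p. \<bar>g p\<bar>)) + 1"
  have g_le: "\<bar>g p\<bar> \<le> K - 1" for p
    unfolding K_def by simp
  have "K > 0"
    using g_le[of undefined] by linarith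
  have [measurable]: "reward g X j t \<in> borel_measurable M" for j t
    unfolding reward_def[abs_def] by (rule mp.measurable_transition)
  \<comment> \<open>The bound does not depend on \<open>t\<close>, so the times
    \<open>\<tau> k\<close> may be arbitrary in the summability argument.\<close>
  have hoeffding: "prob {\<omega> \<in> space M. \<epsilon> \<le> \<bar>(\<Sum>j=0..N. reward g X j t \<omega> - e t) / real N\<bar>}
      \<le> 2 * exp (- \<epsilon>\<^sup>2 / (4 * K\<^sup>2)) ^ N" if "\<epsilon> > 0" "N \<ge> 1" for \<epsilon> N t
  proof -
    interpret H: Hoeffding_ineq M "{0..N}" "\<lambda>j. reward g X j t" "\<lambda>_. - K" "\<lambda>_. K"
      "\<Sum>j\<in>{0..N}. expectation (reward g X j t)"
    proof unfold_locales
      show "AE \<omega> in M. reward g X j t \<omega> \<in> {- K..K}" for j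
      proof (rule AE_I2)
        fix \<omega>
        show "reward g X j t \<omega> \<in> {- K..K}"
          using g_le[of "(X j t \<omega>, X j (Suc t) \<omega>)"] by (simp add: reward_def abs_le_iff)
      qed
    qed (auto intro: indep)
    have "{\<omega> \<in> space M. \<epsilon> \<le> \<bar>(\<Sum>j=0..N. reward g X j t \<omega> - e t) / real N\<bar>}
        = {\<omega> \<in> space M. \<epsilon> * real N \<le>
            \<bar>(\<Sum>j\<in>{0..N}. reward g X j t \<omega>) - (\<Sum>j\<in>{0..N}. expectation (reward g X j t))\<bar>}"
      using \<open>N \<ge> 1\<close> by (simp add: e_reward sum_subtractf pos_le_divide_eq)
    then have bound: "prob {\<omega> \<in> space M. \<epsilon> \<le> \<bar>(\<Sum>j=0..N. reward g X j t \<omega> - e t) / real N\<bar>}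
        \<le> 2 * exp (- 2 * (\<epsilon> * real N)\<^sup>2 / (\<Sum>j\<in>{0..N}. (K - - K)\<^sup>2))"
      using \<open>\<epsilon> > 0\<close> \<open>K > 0\<close> by (simp only:) (rule H.Hoeffding_ineq_abs_ge, auto)
    \<comment> \<open>The \<open>N + 1\<close> ranges of width \<open>2 * K\<close> give the
      denominator \<open>4 * K\<^sup>2 * (N + 1)\<close>; since \<open>N + 1 \<le> 2 * N\<close>,
      the exponent becomes linear in \<open>N\<close> and the bound geometric.\<close>
    have "- 2 * (\<epsilon> * real N)\<^sup>2 / (\<Sum>j\<in>{0..N}. (K - - K)\<^sup>2) \<le> real N * (- \<epsilon>\<^sup>2 / (4 * K\<^sup>2))"
    proof -
      have "real N * (1 + real N) \<le> 2 * (real N)\<^sup>2"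
        using \<open>N \<ge> 1\<close> by (simp add: power2_eq_square distrib_left)
      then have "\<epsilon>\<^sup>2 * (real N * (1 + real N)) \<le> \<epsilon>\<^sup>2 * (2 * (real N)\<^sup>2)"
        by (rule mult_left_mono) simp
      then show ?thesis
        using \<open>K > 0\<close> by (simp add: divide_simps power_mult_distrib) (simp add: algebra_simps)
    qed
    then have "2 * exp (- 2 * (\<epsilon> * real N)\<^sup>2 / (\<Sum>j\<in>{0..N}. (K - - K)\<^sup>2))
        \<le> 2 * exp (real N * (- \<epsilon>\<^sup>2 / (4 * K\<^sup>2)))"
      by (simp only: exp_le_cancel_iff mult_le_cancel_left_pos zero_less_numeral)
    from order_trans[OF bound this] show ?thesis
      by (simp only: exp_of_nat_mult)
  qed
  have joint: "as_joint_limit M (\<lambda>N t \<omega>. (1 / real N) * (\<Sum>j=0..N. reward g X j t \<omega>)) (\<lambda>_. L)"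
    unfolding as_joint_limit_def
  proof (intro allI impI)
    fix n \<tau> :: "nat \<Rightarrow> nat"
    assume n: "strict_mono n" and \<tau>: "filterlim \<tau> at_top sequentially"
    have "AE \<omega> in M. (\<lambda>k. (\<Sum>j=0..n k. reward g X j (\<tau> k) \<omega> - e (\<tau> k)) / real (n k)) \<longlonglongrightarrow> 0"
    proof (rule AE_tendsto_0_if_summable)
      fix \<epsilon> :: real
      assume "\<epsilon> > 0"
      define q where "q = exp (- \<epsilon>\<^sup>2 / (4 * K\<^sup>2))"
      have q: "0 < q" "q < 1"
        using \<open>\<epsilon> > 0\<close> \<open>K > 0\<close> by (auto simp: q_def)
      show "summable (\<lambda>k. prob {\<omega> \<in> space M.
          \<epsilon> \<le> \<bar>(\<Sum>j=0..n k. reward g X j (\<tau> k) \<omega> - e (\<tau> k)) / real (n k)\<bar>})"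
      proof (rule summable_comparison_test'[where N = 1])
        show "summable (\<lambda>k. 2 * q ^ k)"
          using q by (intro summable_mult summable_geometric) auto
        fix k :: nat
        assume "k \<ge> 1"
        \<comment> \<open>Strict monotonicity enters here: it lets the geometric series in
          \<open>k\<close> dominate.\<close>
        have "k \<le> n k"
          using n by (rule strict_mono_imp_increasing)
        then have "prob {\<omega> \<in> space M.
            \<epsilon> \<le> \<bar>(\<Sum>j=0..n k. reward g X j (\<tau> k) \<omega> - e (\<tau> k)) / real (n k)\<bar>} \<le> 2 * q ^ n k"
          unfolding q_def using \<open>k \<ge> 1\<close> \<open>\<epsilon> > 0\<close> by (intro hoeffding) auto
        also have "\<dots> \<le> 2 * q ^ k"
          using q \<open>k \<le> n k\<close> by (intro mult_left_mono power_decreasing) auto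
        finally show "norm (prob {\<omega> \<in> space M.
            \<epsilon> \<le> \<bar>(\<Sum>j=0..n k. reward g X j (\<tau> k) \<omega> - e (\<tau> k)) / real (n k)\<bar>}) \<le> 2 * q ^ k"
          by simp
      qed
    qed measurable
    then show "AE \<omega> in M. (\<lambda>k. (1 / real (n k)) * (\<Sum>j=0..n k. reward g X j (\<tau> k) \<omega>)) \<longlonglongrightarrow> L"
    proof eventually_elim
      case (elim \<omega>)
      \<comment> \<open>These are the subtracted means, \<open>n k + 1\<close> copies divided by
        \<open>n k\<close>; adding them back restores the empirical mean.\<close>
      have "(\<lambda>k. real (Suc (n k)) / real (n k) * e (\<tau> k)) \<longlonglongrightarrow> 1 * L"
        by (intro tendsto_mult filterlim_compose[OF ratio filterlim_subseq[OF n]]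
            filterlim_compose[OF e_lim \<tau>])
      from tendsto_add[OF elim this] show ?case
        by (simp add: sum_subtractf diff_divide_distrib)
    qed
  qed
  have time: "AE \<omega> in M. (\<lambda>T. (1 / real T) * (\<Sum>\<kappa>=0..T. reward g X i \<kappa> \<omega>)) \<longlonglongrightarrow> L" for i
    using mp.AE_average_tendsto[OF L[unfolded f_def], of i]
  proof eventually_elim
    case (elim \<omega>)
    have "(\<lambda>T. real (Suc T) / real T *
        ((\<Sum>t<Suc T. g (X i t \<omega>, X i (Suc t) \<omega>)) / real (Suc T))) \<longlonglongrightarrow> 1 * L"
      by (intro tendsto_mult ratio LIMSEQ_Suc elim)
    \<comment> \<open>At \<open>T = 0\<close> both sides are 0, because division by zero yields
      0.\<close>
    moreover have "real (Suc T) / real T * ((\<Sum>t<Suc T. g (X i t \<omega>, X i (Suc t) \<omega>)) / real (Suc T))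
        = (1 / real T) * (\<Sum>\<kappa>=0..T. reward g X i \<kappa> \<omega>)" for T
      unfolding reward_def atLeast0AtMost lessThan_Suc_atMost by simp
    ultimately show ?case by (simp only: mult_1_left)
  qed
  show ?thesis
    unfolding asymptotically_ergodic_def
    by (intro allI bexI[of _ "\<lambda>_. L"] conjI joint time) simp
qed

end
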